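(* Let $G=\mathbb{R}^8$ be the free nilpotent Lie group of rank $2$ and step $4$. There exists a nonzero homogeneous polynomial $Q:\mathbb{R}^8\to\mathbb{R}$ such that any abnormal curve (abnormal extremal) $\gamma:[0,1]\to\mathbb{R}^8=G$ with $\gamma(0)=0$ satisfies $Q(\gamma(t))=0$ for all $t\in[0,1]$.
   Context: $\mathfrak g=\mathfrak g_1\oplus\cdots\oplus\mathfrak g_4$ is the free nilpotent real Lie algebra of rank $2$ and step $4$ (dimension $8$), with Hall basis $X_1,\dots,X_8$: $X_1,X_2$ are generators, $X_3=[X_2,X_1]$, $X_4=[X_3,X_1]$, $X_5=[X_3,X_2]$, $X_6=[X_4,X_1]$, $X_7=[X_4,X_2]$, $X_8=[X_5,X_2]$. $G$ is the corresponding connected, simply connected Lie group, identified with $\mathbb{R}^8$ via exponential coordinates of the second type, $x=(x_1,\dots,x_8)\leftrightarrow\exp(x_8X_8)\cdot\ldots\cdot\exp(x_1X_1)$, and $X_1,\dots,X_8$ are viewed as left-invariant vector fields on $\mathbb{R}^8$. In these coordinates $$X_1=\partial_{x_1},\quad X_2=\partial_{x_2}-x_1\partial_{x_3}+\tfrac{x_1^2}{2}\partial_{x_4}+x_1x_2\partial_{x_5}-\tfrac{x_1^3}{6}\partial_{x_6}-\tfrac{x_1^2x_2}{2}\partial_{x_7}-\tfrac{x_1x_2^2}{2}\partial_{x_8}.$$ Homogeneity. The degrees are $d(1)=d(2)=1$, $d(3)=2$, $d(4)=d(5)=3$, $d(6)=d(7)=d(8)=4$. A polynomial $\sum_\alpha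 c_\alpha x^\alpha$ on $\mathbb{R}^8$ is homogeneous of degree $k\ge0$ if $\sum_{j=1}^8\alpha_jd(j)=k$ for every $\alpha$ with $c_\alpha\ne0$. Horizontal curves. A Lipschitz curve $\gamma:[0,1]\to\mathbb{R}^8$ is horizontal if there is $h=(h_1,h_2)\in L^\infty([0,1];\mathbb{R}^2)$ with $\dot\gamma=h_1X_1(\gamma)+h_2X_2(\gamma)$ a.e.; then $h_j=\dot\gamma_j$, $j=1,2$. Abnormal extremals. Let $c_{ij}^k$ be the structure constants, $[X_i,X_j]=\sum_{k=1}^8c_{ij}^kX_k$. A horizontal curve $\gamma:[0,1]\to G$ is an abnormal extremal if there exist Lipschitz functions $\lambda_1,\dots,\lambda_8:[0,1]\to\mathbb{R}$ such that: $(\lambda_1(t),\dots,\lambda_8(t))\neq0$ for every $t\in[0,1]$; $\lambda_1=\lambda_2=0$ on $[0,1]$; and $\dot\lambda_i=-\sum_{k=1}^8\sum_{j=1}^2c_{ij}^k\dot\gamma_j\lambda_k$ a.e. on $[0,1]$ for all $i=1,\dots,8$. *)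

theory Defs
  imports "HOL-Analysis.Analysis"
begin

(* Indices range over the type 8, whose elements are 1, ..., 8; the numeral 8 of this type
   equals 0, so x $ 8 is the last coordinate. *)

lemma exhaust_8:
  fixes i :: 8
  shows "i = 1 \<or> i = 2 \<or> i = 3 \<or> i = 4 \<or> i = 5 \<or> i = 6 \<or> i = 7 \<or> i = 8"
proof (induct i)
  case (of_int z)
  then have "z \<in> {0,1,2,3,4,5,6,7}" by auto
  then show ?case by auto
qed

lemma UNIV_8: "(UNIV :: 8 set) = {1, 2, 3, 4, 5, 6, 7, 8}"
  using exhaust_8 by blast

lemma sum_8: "sum f (UNIV :: 8 set) = f 1 + f 2 + f 3 + f 4 + f 5 + f 6 + f 7 + f 8"
  unfolding UNIV_8 by (simp add: ac_simps)

lemma forall_8: "(\<forall>i::8. P i) \<longleftrightarrow> P 1 \<and> P 2 \<and> P 3 \<and> P 4 \<and> P 5 \<and> P 6 \<and> P 7 \<and> P 8"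
  by (metis exhaust_8)

(* The commutator UV - VU of differentiable vector fields, as derivations. *)
definition lie_bracket ::
    "('a::real_normed_vector \<Rightarrow> 'a) \<Rightarrow> ('a \<Rightarrow> 'a) \<Rightarrow> 'a \<Rightarrow> 'a" where
  "lie_bracket U V x = frechet_derivative V (at x) (U x) - frechet_derivative U (at x) (V x)"

definition X1 :: "real^8 \<Rightarrow> real^8" where
  "X1 x = axis 1 1"

definition X2 :: "real^8 \<Rightarrow> real^8" where
  "X2 x = axis 2 1 - (x$1) *\<^sub>R axis 3 1 + ((x$1)^2 / 2) *\<^sub>R axis 4 1
     + (x$1 * x$2) *\<^sub>R axis 5 1 - ((x$1)^3 / 6) *\<^sub>R axis 6 1
     - ((x$1)^2 * x$2 / 2) *\<^sub>R axis 7 1 - (x$1 * (x$2)^2 / 2) *\<^sub>R axis 8 1"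

definition X3 :: "real^8 \<Rightarrow> real^8" where "X3 = lie_bracket X2 X1"
definition X4 :: "real^8 \<Rightarrow> real^8" where "X4 = lie_bracket X3 X1"
definition X5 :: "real^8 \<Rightarrow> real^8" where "X5 = lie_bracket X3 X2"
definition X6 :: "real^8 \<Rightarrow> real^8" where "X6 = lie_bracket X4 X1"
definition X7 :: "real^8 \<Rightarrow> real^8" where "X7 = lie_bracket X4 X2"
definition X8 :: "real^8 \<Rightarrow> real^8" where "X8 = lie_bracket X5 X2"

definition hall :: "8 \<Rightarrow> real^8 \<Rightarrow> real^8" where
  "hall i = (if i = 1 then X1 else if i = 2 then X2 else if i = 3 then X3 else if i = 4 then X4
          else if i = 5 then X5 else if i = 6 then X6 else if i = 7 then X7 else X8)"

lemma lie_bracketI: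
  assumes "(U has_derivative U') (at x)" "(V has_derivative V') (at x)"
  shows "lie_bracket U V x = V' (U x) - U' (V x)"
  using assms by (simp add: lie_bracket_def frechet_derivative_at[symmetric])

lemma has_derivative_nth_8:
  "((f :: _ \<Rightarrow> real^8) has_derivative f') F \<Longrightarrow> ((\<lambda>x. f x $ i) has_derivative (\<lambda>x. f' x $ i)) F"
  by (rule bounded_linear.has_derivative[OF bounded_linear_vec_nth])

lemma dX1: "(X1 has_derivative (\<lambda>v. 0)) (at x)"
  unfolding X1_def[abs_def] by (rule has_derivative_const)

lemma dX2: "(X2 has_derivative (\<lambda>v. - (v$1) *\<^sub>R axis 3 1 + (x$1 * v$1) *\<^sub>R axis 4 1
     + (x$1 * v$2 + v$1 * x$2) *\<^sub>R axis 5 1 - ((x$1)^2 * v$1 / 2) *\<^sub>R axis 6 1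
     - (x$1 * v$1 * x$2 + (x$1)^2 * v$2 / 2) *\<^sub>R axis 7 1
     - (v$1 * (x$2)^2 / 2 + x$1 * x$2 * v$2) *\<^sub>R axis 8 1)) (at x)"
  unfolding X2_def[abs_def]
  apply (rule has_derivative_eq_rhs)
   apply (rule derivative_intros has_derivative_nth_8 | simp (no_asm))+
  apply (simp only: fun_eq_iff vec_eq_iff forall_8)
  apply (simp add: axis_def field_simps power2_eq_square)
  done

lemma X3_eq: "X3 = (\<lambda>x. axis 3 1 - (x$1) *\<^sub>R axis 4 1 - (x$2) *\<^sub>R axis 5 1
     + ((x$1)^2 / 2) *\<^sub>R axis 6 1 + (x$1 * x$2) *\<^sub>R axis 7 1 + ((x$2)^2 / 2) *\<^sub>R axis 8 1)"
  unfolding X3_def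
  by (rule ext, subst lie_bracketI[OF dX2 dX1])
    (simp add: X1_def X2_def vec_eq_iff forall_8 axis_def)

lemma dX3: "(X3 has_derivative (\<lambda>v. - (v$1) *\<^sub>R axis 4 1 - (v$2) *\<^sub>R axis 5 1
     + (x$1 * v$1) *\<^sub>R axis 6 1 + (v$1 * x$2 + x$1 * v$2) *\<^sub>R axis 7 1
     + (x$2 * v$2) *\<^sub>R axis 8 1)) (at x)"
  unfolding X3_eq
  apply (rule has_derivative_eq_rhs)
   apply (rule derivative_intros has_derivative_nth_8 | simp (no_asm))+
  apply (simp only: fun_eq_iff vec_eq_iff forall_8)
  apply (simp add: axis_def field_simps power2_eq_square)
  done

lemma X4_eq: "X4 = (\<lambda>x. axis 4 1 - (x$1) *\<^sub>R axis 6 1 - (x$2) *\<^sub>R axis 7 1)"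
  unfolding X4_def
  by (rule ext, subst lie_bracketI[OF dX3 dX1])
    (simp add: X1_def X2_def vec_eq_iff forall_8 axis_def)

lemma dX4: "(X4 has_derivative (\<lambda>v. - (v$1) *\<^sub>R axis 6 1 - (v$2) *\<^sub>R axis 7 1)) (at x)"
  unfolding X4_eq
  apply (rule has_derivative_eq_rhs)
   apply (rule derivative_intros has_derivative_nth_8 | simp (no_asm))+
  done

lemma X5_eq: "X5 = (\<lambda>x. axis 5 1 - (x$1) *\<^sub>R axis 7 1 - (x$2) *\<^sub>R axis 8 1)"
  unfolding X5_def
  by (rule ext, subst lie_bracketI[OF dX3 dX2])
    (simp add: X1_def X2_def X3_eq vec_eq_iff forall_8 axis_def)

lemma dX5: "(X5 has_derivative (\<lambda>v. - (v$1) *\<^sub>R axis 7 1 - (v$2) *\<^sub>R axis 8 1)) (at x)"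
  unfolding X5_eq
  apply (rule has_derivative_eq_rhs)
   apply (rule derivative_intros has_derivative_nth_8 | simp (no_asm))+
  done

lemma X6_eq: "X6 = (\<lambda>x. axis 6 1)"
  unfolding X6_def
  by (rule ext, subst lie_bracketI[OF dX4 dX1])
    (simp add: X1_def X2_def vec_eq_iff forall_8 axis_def)

lemma X7_eq: "X7 = (\<lambda>x. axis 7 1)"
  unfolding X7_def
  by (rule ext, subst lie_bracketI[OF dX4 dX2])
    (simp add: X1_def X2_def X4_eq vec_eq_iff forall_8 axis_def)

lemma X8_eq: "X8 = (\<lambda>x. axis 8 1)"
  unfolding X8_def
  by (rule ext, subst lie_bracketI[OF dX5 dX2])
    (simp add: X1_def X2_def X5_eq vec_eq_iff forall_8 axis_def)

lemma dX678: "(X6 has_derivative (\<lambda>v. 0)) (at x)" "(X7 has_derivative (\<lambda>v. 0)) (at x)"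
    "(X8 has_derivative (\<lambda>v. 0)) (at x)"
  unfolding X6_eq X7_eq X8_eq by (rule has_derivative_const)+

lemmas hall_derivs = dX1 dX2 dX3 dX4 dX5 dX678

(* Existence and uniqueness are proved below, so the description in struct_const is proper. *)
definition is_struct_const :: "(8 \<Rightarrow> 8 \<Rightarrow> 8 \<Rightarrow> real) \<Rightarrow> bool" where
  "is_struct_const c \<longleftrightarrow> (\<forall>i j x. lie_bracket (hall i) (hall j) x = (\<Sum>k\<in>UNIV. c i j k *\<^sub>R hall k x))"

definition struct_const :: "8 \<Rightarrow> 8 \<Rightarrow> 8 \<Rightarrow> real" where
  "struct_const = (THE c. is_struct_const c)"

definition struct_table :: "(8 \<times> 8 \<times> 8) set" where
  "struct_table = {(2,1,3), (3,1,4), (3,2,5), (4,1,6), (4,2,7), (5,1,7), (5,2,8)}"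

lemma hall_simps: "hall 1 = X1" "hall 2 = X2" "hall 3 = X3" "hall 4 = X4"
  "hall 5 = X5" "hall 6 = X6" "hall 7 = X7" "hall 8 = X8"
  by (simp_all add: hall_def)

lemma is_struct_const_unique:
  assumes "is_struct_const c" "is_struct_const c'"
  shows "c = c'"
proof (intro ext)
  fix i j k
  have X0: "hall k 0 = axis k 1" for k
    using exhaust_8[of k]
    by (auto simp: hall_simps X1_def X2_def X3_eq X4_eq X5_eq X6_eq X7_eq X8_eq)
  have "(\<Sum>k\<in>UNIV. c i j k *\<^sub>R hall k 0) $ k = (\<Sum>k\<in>UNIV. c' i j k *\<^sub>R hall k 0) $ k"
    using assms unfolding is_struct_const_def by metis
  then show "c i j k = c' i j k"
    by (simp add: X0 axis_def if_distrib cong: if_cong)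
qed

lemma is_struct_const_table:
  "is_struct_const (\<lambda>i j k. if (i,j,k) \<in> struct_table then 1
     else if (j,i,k) \<in> struct_table then -1 else 0)"
proof -
  note sums = sum_8 hall_simps struct_table_def
  note fields = X1_def X2_def X3_eq X4_eq X5_eq X6_eq X7_eq X8_eq
  note br = hall_derivs[THEN lie_bracketI, OF hall_derivs(1)] hall_derivs[THEN lie_bracketI, OF hall_derivs(2)]
    hall_derivs[THEN lie_bracketI, OF hall_derivs(3)] hall_derivs[THEN lie_bracketI, OF hall_derivs(4)]
    hall_derivs[THEN lie_bracketI, OF hall_derivs(5)] hall_derivs[THEN lie_bracketI, OF hall_derivs(6)]
    hall_derivs[THEN lie_bracketI, OF hall_derivs(7)] hall_derivs[THEN lie_bracketI, OF hall_derivs(8)]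
  have nth: "X1 x $ 1 = 1" "X1 x $ 2 = 0" "X2 x $ 1 = 0" "X2 x $ 2 = 1"
    "X3 x $ 1 = 0" "X3 x $ 2 = 0" "X4 x $ 1 = 0" "X4 x $ 2 = 0" "X5 x $ 1 = 0" "X5 x $ 2 = 0"
    "X6 x $ 1 = 0" "X6 x $ 2 = 0" "X7 x $ 1 = 0" "X7 x $ 2 = 0" "X8 x $ 1 = 0" "X8 x $ 2 = 0" for x
    by (simp_all add: fields axis_def)
  show ?thesis
    unfolding is_struct_const_def
    by (simp add: forall_8 sums br nth; simp add: fields field_simps)
qed

lemma struct_const_eq:
  "struct_const i j k = (if (i,j,k) \<in> struct_table then 1
     else if (j,i,k) \<in> struct_table then -1 else 0)"
  using the_equality[of is_struct_const, OF is_struct_const_table]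
    is_struct_const_unique[OF _ is_struct_const_table]
  unfolding struct_const_def by simp


(* The Lie algebra spanned by X1, ..., X8, in coordinates with respect to this basis, is nilpotent
   of step 4, and it is the free such algebra on its first two basis vectors. *)

lemma hall_lie_algebra:
  fixes u v w y z :: "real^8"
  defines "br \<equiv> \<lambda>u v :: real^8. (\<chi> k. \<Sum>i\<in>UNIV. \<Sum>j\<in>UNIV. struct_const i j k * u$i * v$j)"
  shows "bilinear br" "br u u = 0"
    "br u (br v w) + br v (br w u) + br w (br u v) = 0"
    "br (br (br (br u v) w) y) z = 0"
proof -
  have br: "br u v $ 1 = 0" "br u v $ 2 = 0" "br u v $ 3 = u$2 * v$1 - u$1 * v$2"
      "br u v $ 4 = u$3 * v$1 - u$1 * v$3" "br u v $ 5 = u$3 * v$2 - u$2 * v$3"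
      "br u v $ 6 = u$4 * v$1 - u$1 * v$4"
      "br u v $ 7 = u$4 * v$2 - u$2 * v$4 + u$5 * v$1 - u$1 * v$5"
      "br u v $ 8 = u$5 * v$2 - u$2 * v$5" for u v
    unfolding br_def by (simp_all add: sum_8 struct_const_eq struct_table_def)
  show "bilinear br"
    unfolding bilinear_def linear_iff by (simp add: vec_eq_iff forall_8 br algebra_simps)
  show "br u u = 0" "br u (br v w) + br v (br w u) + br w (br u v) = 0"
    "br (br (br (br u v) w) y) z = 0"
    by (simp_all add: vec_eq_iff forall_8 br algebra_simps)
qed

lemma hall_universal:
  fixes B :: "'b::real_vector \<Rightarrow> 'b \<Rightarrow> 'b" and a b :: 'b
  assumes bil: "bilinear B" and alt: "\<And>u. B u u = 0"
    and jac: "\<And>u v w. B u (B v w) + B v (B w u) + B w (B u v) = 0"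
    and nil: "\<And>u v w y z. B (B (B (B u v) w) y) z = 0"
  shows "\<exists>!f :: real^8 \<Rightarrow> 'b. linear f \<and> f (axis 1 1) = a \<and> f (axis 2 1) = b \<and>
    (\<forall>i j. B (f (axis i 1)) (f (axis j 1)) = (\<Sum>k\<in>UNIV. struct_const i j k *\<^sub>R f (axis k 1)))"
    (is "\<exists>!f. ?P f")
proof (rule ex_ex1I)
  have skew: "B u v = - B v u" for u v
  proof -
    have "B u u + B u v + (B v u + B v v) = 0"
      using alt[of "u + v"] by (simp only: bilinear_ladd[OF bil] bilinear_radd[OF bil] ac_simps)
    then show ?thesis by (simp add: alt eq_neg_iff_add_eq_0)
  qed
  have leib: "B u (B v w) = B (B u v) w - B (B u w) v" for u v w
  proof -
    have "B v (B w u) = B (B u w) v"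
      using skew[of v "B w u"] skew[of w u] by (simp add: bilinear_lneg[OF bil])
    moreover have "B w (B u v) = - B (B u v) w" by (rule skew)
    moreover have "B u (B v w) = - (B v (B w u) + B w (B u v))"
      using jac[of u v w] by (simp only: eq_neg_iff_add_eq_0 add.assoc)
    ultimately show ?thesis by simp
  qed
  define e3 e4 e5 e6 e7 e8
    where e: "e3 = B b a" "e4 = B e3 a" "e5 = B e3 b" "e6 = B e4 a" "e7 = B e4 b" "e8 = B e5 b"
  define g where "g = (\<lambda>i::8. if i = 1 then a else if i = 2 then b else if i = 3 then e3
    else if i = 4 then e4 else if i = 5 then e5 else if i = 6 then e6 else if i = 7 then e7 else e8)"
  have g: "g 1 = a" "g 2 = b" "g 3 = e3" "g 4 = e4" "g 5 = e5" "g 6 = e6" "g 7 = e7" "g 8 = e8"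
    by (simp_all add: g_def)
  have e5a: "B e5 a = e7"
    using leib[of e3 b a] by (simp add: e alt flip: e)
  have z: "B e6 u = 0" "B e7 u = 0" "B e8 u = 0" for u
    by (simp_all add: e nil)
  have z': "B u e6 = 0" "B u e7 = 0" "B u e8 = 0" for u
    using z skew[of u] by simp_all
  have y: "B e4 e3 = 0" "B e5 e3 = 0"
    by (simp_all add: e leib nil)
  have y': "B e3 e4 = 0" "B e3 e5 = 0"
    using y skew[of e3] by simp_all
  have x: "B e4 e5 = 0" "B e5 e4 = 0"
    using leib[of e4 e3 b] leib[of e5 e3 a] y z(2) e5a
    by (simp_all add: bilinear_lzero[OF bil] flip: e(2-))
  have pos: "B b a = e3" "B e3 a = e4" "B e3 b = e5" "B e4 a = e6" "B e4 b = e7" "B e5 a = e7" "B e5 b = e8"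
    using e5a by (simp_all add: e)
  have neg: "B a b = - e3" "B a e3 = - e4" "B b e3 = - e5" "B a e4 = - e6" "B b e4 = - e7"
      "B a e5 = - e7" "B b e5 = - e8"
    using skew[of a b] skew[of a e3] skew[of b e3] skew[of a e4] skew[of b e4] skew[of a e5] skew[of b e5]
    by (simp_all only: pos)
  have "\<forall>i j. B (g i) (g j) = (\<Sum>k\<in>UNIV. struct_const i j k *\<^sub>R g k)"
    by (simp add: forall_8 sum_8 struct_const_eq struct_table_def g alt pos neg x y y' z z')
  then have st: "B (g i) (g j) = (\<Sum>k\<in>UNIV. struct_const i j k *\<^sub>R g k)" for i j
    by blast
  define f where "f = (\<lambda>u::real^8. \<Sum>i\<in>UNIV. u$i *\<^sub>R g i)"
  have fg: "f (axis i 1) = g i" for i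
    by (simp add: f_def axis_def if_distrib[of "\<lambda>c. c *\<^sub>R _"] cong: if_cong)
  have "linear f"
    by (rule linearI) (simp_all add: f_def scaleR_add_left sum.distrib scaleR_sum_right)
  then show "\<exists>f. ?P f"
    using st by (intro exI[of _ f]) (simp add: fg g)
next
  fix f f' assume P: "?P f" "?P f'"
  have gen: "h (axis 3 1) = B b a \<and> h (axis 4 1) = B (B b a) a \<and> h (axis 5 1) = B (B b a) b \<and>
      h (axis 6 1) = B (B (B b a) a) a \<and> h (axis 7 1) = B (B (B b a) a) b \<and>
      h (axis 8 1) = B (B (B b a) b) b" if "?P h" for h
  proof -
    have rel: "B (h (axis i 1)) (h (axis j 1)) = (\<Sum>k\<in>UNIV. struct_const i j k *\<^sub>R h (axis k 1))" for i j
      using that by blast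
    have "h (axis 1 1) = a" "h (axis 2 1) = b"
      using that by auto
    then show ?thesis
      using rel[of 2 1] rel[of 3 1] rel[of 3 2] rel[of 4 1] rel[of 4 2] rel[of 5 2]
      by (simp add: sum_8 struct_const_eq struct_table_def)
  qed
  have "\<forall>i. f (axis i 1) = f' (axis i 1)"
    unfolding forall_8 using P gen[OF P(1)] gen[OF P(2)] by simp
  then show "f = f'"
    using P by (intro linear_eq_stdbasis) (auto simp: Basis_vec_def)
qed

(* The group law of G in the coordinates x <-> exp (x8 X8) ... exp (x1 X1): the product of x and y
   is reached from x by following X8 for time y8, then X7 for time y7, ..., then X1 for time y1.
   The lemmas show that the fields X1, ..., X8 are left-invariant for it and that the
   coordinates are those of the second type. *)

definition grp_mult :: "real^8 \<Rightarrow> real^8 \<Rightarrow> real^8" where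
  "grp_mult x y = x + y
     - (x$1 * y$2) *\<^sub>R axis 3 1
     + ((x$1)^2 / 2 * y$2 - x$1 * y$3) *\<^sub>R axis 4 1
     + (x$1 * x$2 * y$2 + x$1 * (y$2)^2 / 2 - x$2 * y$3) *\<^sub>R axis 5 1
     + ((x$1)^2 / 2 * y$3 - x$1 * y$4 - (x$1)^3 / 6 * y$2) *\<^sub>R axis 6 1
     + (x$1 * x$2 * y$3 - x$1 * y$5 - x$2 * y$4
        - (x$1)^2 / 2 * (x$2 * y$2 + (y$2)^2 / 2)) *\<^sub>R axis 7 1
     + ((x$2)^2 / 2 * y$3 - x$2 * y$5
        - x$1 / 2 * ((x$2)^2 * y$2 + x$2 * (y$2)^2 + (y$2)^3 / 3)) *\<^sub>R axis 8 1"

lemma grp_mult_nth: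
  "grp_mult x y $ 1 = x$1 + y$1" "grp_mult x y $ 2 = x$2 + y$2"
  "grp_mult x y $ 3 = x$3 + y$3 - x$1 * y$2"
  "grp_mult x y $ 4 = x$4 + y$4 + (x$1)^2 / 2 * y$2 - x$1 * y$3"
  "grp_mult x y $ 5 = x$5 + y$5 + x$1 * x$2 * y$2 + x$1 * (y$2)^2 / 2 - x$2 * y$3"
  "grp_mult x y $ 6 = x$6 + y$6 + (x$1)^2 / 2 * y$3 - x$1 * y$4 - (x$1)^3 / 6 * y$2"
  "grp_mult x y $ 7 = x$7 + y$7 + x$1 * x$2 * y$3 - x$1 * y$5 - x$2 * y$4
        - (x$1)^2 / 2 * (x$2 * y$2 + (y$2)^2 / 2)"
  "grp_mult x y $ 8 = x$8 + y$8 + (x$2)^2 / 2 * y$3 - x$2 * y$5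
        - x$1 / 2 * ((x$2)^2 * y$2 + x$2 * (y$2)^2 + (y$2)^3 / 3)"
  by (simp_all add: grp_mult_def axis_def)

lemma grp_mult_assoc: "grp_mult (grp_mult x y) z = grp_mult x (grp_mult y z)"
  by (simp add: vec_eq_iff forall_8 grp_mult_nth)
     (simp add: field_simps power2_eq_square power3_eq_cube)

lemma grp_mult_0: "grp_mult 0 x = x" "grp_mult x 0 = x"
  by (simp_all add: vec_eq_iff forall_8 grp_mult_nth)

lemma grp_mult_inverse: "\<exists>y. grp_mult y x = 0"
proof -
  define a where "a = - x$1"
  define b where "b = - x$2"
  define p where "p = - x$3 + a * x$2"
  define q where "q = - (x$4 + a^2 / 2 * x$2 - a * x$3)"
  define r where "r = - (x$5 + a * b * x$2 + a * (x$2)^2 / 2 - b * x$3)"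
  define s where "s = - (x$6 + a^2 / 2 * x$3 - a * x$4 - a^3 / 6 * x$2)"
  define t where "t = - (x$7 + a * b * x$3 - a * x$5 - b * x$4 - a^2 / 2 * (b * x$2 + (x$2)^2 / 2))"
  define u where "u = - (x$8 + b^2 / 2 * x$3 - b * x$5 - a / 2 * (b^2 * x$2 + b * (x$2)^2 + (x$2)^3 / 3))"
  have "grp_mult (axis 1 a + axis 2 b + axis 3 p + axis 4 q + axis 5 r + axis 6 s + axis 7 t + axis 8 u) x = 0"
    by (simp add: vec_eq_iff forall_8 grp_mult_nth axis_def)
       (simp add: a_def[symmetric] b_def[symmetric] p_def q_def r_def s_def t_def u_def, simp add: a_def b_def)
  then show ?thesis ..
qed

lemma hall_left_invariant:
  "(grp_mult x has_derivative (\<lambda>v. v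
     - (x$1 * v$2) *\<^sub>R axis 3 1
     + ((x$1)^2 / 2 * v$2 - x$1 * v$3) *\<^sub>R axis 4 1
     + (x$1 * x$2 * v$2 + x$1 * y$2 * v$2 - x$2 * v$3) *\<^sub>R axis 5 1
     + ((x$1)^2 / 2 * v$3 - x$1 * v$4 - (x$1)^3 / 6 * v$2) *\<^sub>R axis 6 1
     + (x$1 * x$2 * v$3 - x$1 * v$5 - x$2 * v$4
        - (x$1)^2 / 2 * (x$2 * v$2 + y$2 * v$2)) *\<^sub>R axis 7 1
     + ((x$2)^2 / 2 * v$3 - x$2 * v$5
        - x$1 / 2 * ((x$2)^2 * v$2 + 2 * x$2 * y$2 * v$2 + (y$2)^2 * v$2)) *\<^sub>R axis 8 1)) (at y)"
    (is "(_ has_derivative ?D) _")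
  "frechet_derivative (grp_mult x) (at y) (hall i y) = hall i (grp_mult x y)"
proof -
  show D: "(grp_mult x has_derivative ?D) (at y)"
    unfolding grp_mult_def[abs_def]
    apply (rule has_derivative_eq_rhs)
     apply (rule derivative_intros has_derivative_nth_8 | simp (no_asm))+
    apply (simp only: fun_eq_iff vec_eq_iff forall_8)
    apply (simp add: axis_def field_simps power2_eq_square)
    done
  have "\<forall>i. ?D (hall i y) = hall i (grp_mult x y)"
    unfolding forall_8 hall_simps X1_def X2_def X3_eq X4_eq X5_eq X6_eq X7_eq X8_eq
    by (simp add: vec_eq_iff forall_8 grp_mult_nth axis_def)
       (simp add: field_simps power2_eq_square power3_eq_cube)
  then show "frechet_derivative (grp_mult x) (at y) (hall i y) = hall i (grp_mult x y)"
    using D by (simp add: frechet_derivative_at[symmetric])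
qed

lemma exp_hall: "((\<lambda>t. axis i t) has_vector_derivative hall i (axis i t)) (at t)"
proof -
  have "hall i (axis i t) = axis i 1"
    using exhaust_8[of i]
    by (elim disjE) (simp_all add: hall_simps X1_def X2_def X3_eq X4_eq X5_eq X6_eq X7_eq X8_eq
        vec_eq_iff forall_8 axis_def)
  moreover have "((\<lambda>t. t *\<^sub>R axis i (1::real)) has_vector_derivative axis i 1) (at t)"
    by (auto intro!: derivative_eq_intros)
  moreover have "(\<lambda>t. t *\<^sub>R axis i (1::real)) = axis i"
    by (simp add: fun_eq_iff vec_eq_iff axis_def)
  ultimately show ?thesis by simp
qed

lemma second_type_coordinates:
  "x = grp_mult (axis 8 (x$8)) (grp_mult (axis 7 (x$7)) (grp_mult (axis 6 (x$6))
     (grp_mult (axis 5 (x$5)) (grp_mult (axis 4 (x$4)) (grp_mult (axis 3 (x$3))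
       (grp_mult (axis 2 (x$2)) (axis 1 (x$1))))))))"
  by (simp add: vec_eq_iff forall_8 grp_mult_nth axis_def)

definition hdeg :: "8 \<Rightarrow> nat" where
  "hdeg j = (if j \<in> {1, 2} then 1 else if j = 3 then 2 else if j \<in> {4, 5} then 3 else 4)"

(* c gives the coefficients of Q, indexed by exponent vectors. *)
definition homogeneous_polynomial :: "nat \<Rightarrow> (real^8 \<Rightarrow> real) \<Rightarrow> bool" where
  "homogeneous_polynomial k Q \<longleftrightarrow>
     (\<exists>c :: (8 \<Rightarrow> nat) \<Rightarrow> real. finite {\<alpha>. c \<alpha> \<noteq> 0} \<and>
        (\<forall>x. Q x = (\<Sum>\<alpha> | c \<alpha> \<noteq> 0. c \<alpha> * (\<Prod>j\<in>UNIV. (x$j) ^ \<alpha> j))) \<and>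
        (\<forall>\<alpha>. c \<alpha> \<noteq> 0 \<longrightarrow> (\<Sum>j\<in>UNIV. \<alpha> j * hdeg j) = k))"

definition L_infinity :: "(real \<Rightarrow> real^2) \<Rightarrow> bool" where
  "L_infinity h \<longleftrightarrow> h \<in> borel_measurable (lebesgue_on {0..1}) \<and>
     (\<exists>C. AE t in lebesgue_on {0..1}. norm (h t) \<le> C)"

definition horizontal :: "(real \<Rightarrow> real^8) \<Rightarrow> bool" where
  "horizontal \<gamma> \<longleftrightarrow> (\<exists>C. C-lipschitz_on {0..1} \<gamma>) \<and>
     (\<exists>h. L_infinity h \<and>
       (AE t in lebesgue_on {0..1}. (\<gamma> has_vector_derivative
          (h t $ 1) *\<^sub>R X1 (\<gamma> t) + (h t $ 2) *\<^sub>R X2 (\<gamma> t)) (at t within {0..1})))"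

definition abnormal_extremal :: "(real \<Rightarrow> real^8) \<Rightarrow> bool" where
  "abnormal_extremal \<gamma> \<longleftrightarrow> horizontal \<gamma> \<and>
     (\<exists>lam :: 8 \<Rightarrow> real \<Rightarrow> real.
        (\<forall>i. \<exists>C. C-lipschitz_on {0..1} (lam i)) \<and>
        (\<forall>t\<in>{0..1}. \<exists>i. lam i t \<noteq> 0) \<and>
        (\<forall>t\<in>{0..1}. lam 1 t = 0 \<and> lam 2 t = 0) \<and>
        (\<forall>i. AE t in lebesgue_on {0..1}. (lam i has_vector_derivative
           - (\<Sum>k\<in>UNIV. \<Sum>j\<in>{1, 2}. struct_const i j k *
               vector_derivative (\<lambda>s. \<gamma> s $ j) (at t within {0..1}) * lam k t))
           (at t within {0..1})))"

end

(* Along an abnormal extremal starting at 0, integrating the adjoint equations expresses lam 3 as a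
   polynomial p(x1, x2) of degree at most 2. Since lam 1 = lam 2 = 0, either the curve is constant
   or lam 3 = 0; in the latter case p is not identically zero and p(0) = 0, so that the plane
   projection lies on the conic p = 0. Integrating p dx2, - p dx1, p x1 dx2 and p x2 dx2 along the
   curve gives four more identities, which the shape of X2 turns into polynomial ones in
   x1, ..., x8. All five are linear in the five coefficients of p, so the determinant of this
   system vanishes along the curve. *)

theory Submission
  imports Defs
begin

section \<open>Lipschitz functions and their derivatives almost everywhere\<close>

text \<open>Sard's theorem in dimension one. The set \<open>E\<close> is arbitrary and the
  derivative is taken within \<open>E\<close>, so the lemma applies to an interval with a null set
  removed.\<close>

lemma negligible_image_real_derivative_zero:
  fixes f :: "real \<Rightarrow> real"
  assumes "\<And>x. x \<in> E \<Longrightarrow> (f has_real_derivative 0) (at x within E)"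
  shows "negligible (f ` E)"
proof -
  \<comment> \<open>\<open>baby_Sard\<close> concerns maps between Cartesian powers of the reals, so
    \<open>f\<close> is moved to \<open>real^1\<close> as \<open>g\<close>. The image is brought
    back by the coordinate projection, which is 1-Lipschitz and hence preserves null sets.\<close>
  define S where "S = {x :: real^1. x $ 1 \<in> E}"
  define g where "g = (\<lambda>x :: real^1. (vec (f (x $ 1)) :: real^1))"
  have "negligible (g ` S)"
  proof (rule baby_Sard)
    fix x assume x: "x \<in> S"
    have "(f has_derivative (\<lambda>h. 0)) (at (x $ 1) within E)"
      using assms[of "x $ 1"] x by (simp add: has_field_derivative_def S_def lambda_zero)
    then have "(f has_derivative (\<lambda>h. 0)) (at (x $ 1) within (\<lambda>y. y $ 1) ` S)"
      by (rule has_derivative_subset) (auto simp: S_def)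
    moreover have "((\<lambda>y. y $ 1) has_derivative (\<lambda>h. h $ 1)) (at x within S)"
      by (rule bounded_linear_imp_has_derivative[OF bounded_linear_vec_nth])
    ultimately have "((\<lambda>y. f (y $ 1)) has_derivative (\<lambda>h. 0)) (at x within S)"
      using diff_chain_within[of "\<lambda>y. y $ 1" "\<lambda>h. h $ 1" x S f "\<lambda>h. 0"] by (simp add: o_def)
    then have "((\<lambda>y. f (y $ 1) *\<^sub>R (1 :: real^1)) has_derivative (\<lambda>h. 0 *\<^sub>R 1)) (at x within S)"
      by (rule has_derivative_scaleR_left)
    moreover have "g = (\<lambda>y. f (y $ 1) *\<^sub>R 1)"
      by (simp add: g_def fun_eq_iff vec_eq_iff)
    ultimately show "(g has_derivative (\<lambda>h. 0)) (at x within S)"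
      by simp
    show "rank (matrix ((\<lambda>h. 0) :: real^1 \<Rightarrow> real^1)) < CARD(1)"
      by (simp add: rank_dim_range)
  qed simp
  then have "negligible ((\<lambda>y :: real^1. y $ 1) ` g ` S)"
  proof (rule negligible_locally_Lipschitz_image[rotated])
    fix x :: "real^1"
    show "\<exists>T B. open T \<and> x \<in> T \<and> (\<forall>y\<in>g ` S \<inter> T. norm (y $ 1 - x $ 1) \<le> B * norm (y - x))"
      by (intro exI[of _ UNIV] exI[of _ 1])
        (auto simp: component_le_norm_cart simp flip: vector_minus_component)
  qed simp
  moreover have "f ` E \<subseteq> (\<lambda>y :: real^1. y $ 1) ` g ` S"
  proof
    fix y assume "y \<in> f ` E"
    then obtain x where "x \<in> E" "y = f x" by blast
    then have "y = g (vec x) $ 1" "vec x \<in> S"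
      by (simp_all add: g_def S_def)
    then show "y \<in> (\<lambda>y :: real^1. y $ 1) ` g ` S" by blast
  qed
  ultimately show ?thesis
    by (rule negligible_subset)
qed

text \<open>The image of the interval is null: the exceptional null set has null image because
  \<open>f\<close> is Lipschitz, and the remaining points have null image by Sard. The image is also
  connected, so it contains the segment from \<open>f a\<close> to \<open>f x\<close>; a null
  segment is a single point.\<close>

lemma lipschitz_AE_derivative_zero_constant:
  fixes f :: "real \<Rightarrow> real"
  assumes lip: "C-lipschitz_on {a..b} f"
    and der: "AE x in lebesgue_on {a..b}. (f has_real_derivative 0) (at x within {a..b})"
    and x: "x \<in> {a..b}"
  shows "f x = f a"
proof -
  obtain N where N: "N \<in> null_sets (lebesgue_on {a..b})"
    and sub: "{x \<in> space (lebesgue_on {a..b}). \<not> (f has_real_derivative 0) (at x within {a..b})} \<subseteq> N"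
    using der unfolding eventually_ae_filter by blast
  have "negligible N" "N \<subseteq> {a..b}"
    using N by (auto simp: null_sets_restrict_space negligible_iff_null_sets)
  have "negligible (f ` N)"
  proof (rule negligible_locally_Lipschitz_image[OF _ \<open>negligible N\<close>])
    fix x assume "x \<in> N"
    then show "\<exists>T B. open T \<and> x \<in> T \<and> (\<forall>y\<in>N \<inter> T. norm (f y - f x) \<le> B * norm (y - x))"
      using lipschitz_on_normD[OF lip] \<open>N \<subseteq> {a..b}\<close>
      by (intro exI[of _ UNIV] exI[of _ C]) blast
  qed simp
  moreover have "negligible (f ` ({a..b} - N))"
  proof (rule negligible_image_real_derivative_zero)
    fix x assume "x \<in> {a..b} - N"
    then have "(f has_real_derivative 0) (at x within {a..b})"
      using sub by auto
    then show "(f has_real_derivative 0) (at x within {a..b} - N)"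
      by (rule DERIV_subset) auto
  qed
  ultimately have "negligible (f ` N \<union> f ` ({a..b} - N))"
    by (rule negligible_Un)
  then have "negligible (f ` {a..b})"
    by (rule negligible_subset) blast
  moreover have "connected (f ` {a..b})"
    using lipschitz_on_continuous_on[OF lip] by (intro connected_continuous_image) auto
  then have "closed_segment (f a) (f x) \<subseteq> f ` {a..b}"
    using x by (intro closed_segment_subset) (simp_all flip: connected_convex_1)
  ultimately have "negligible (closed_segment (f a) (f x))"
    by (rule negligible_subset)
  moreover have "closed_segment (f a) (f x) = cbox (min (f a) (f x)) (max (f a) (f x))"
    by (simp add: closed_segment_eq_real_ivl)
  ultimately have "box (min (f a) (f x)) (max (f a) (f x)) = {}"
    using negligible_interval(1) by metis
  then show ?thesis
    by (simp add: min_def max_def split: if_splits)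
qed

text \<open>The Lipschitz condition is part of the notion because a derivative that vanishes almost
  everywhere does not by itself make a continuous function constant, as the Cantor function shows.
  The function \<open>f'\<close> matters only up to null sets.\<close>

definition AE_derivative :: "(real \<Rightarrow> real) \<Rightarrow> (real \<Rightarrow> real) \<Rightarrow> bool" where
  "AE_derivative f f' \<longleftrightarrow> (\<exists>C. C-lipschitz_on {0..1} f) \<and>
     (AE t in lebesgue_on {0..1}. (f has_real_derivative f' t) (at t within {0..1}))"

section \<open>Calculus of almost everywhere derivatives\<close>

lemma AE_derivative_const: "AE_derivative (\<lambda>t. c) (\<lambda>t. 0)"
  unfolding AE_derivative_def by (auto intro: lipschitz_on_constant)

lemma AE_derivative_add:
  assumes "AE_derivative f f'" "AE_derivative g g'"
  shows "AE_derivative (\<lambda>t. f t + g t) (\<lambda>t. f' t + g' t)"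
  using assms unfolding AE_derivative_def
  by (auto intro: lipschitz_on_add DERIV_add elim!: eventually_elim2)

lemma AE_derivative_diff:
  assumes "AE_derivative f f'" "AE_derivative g g'"
  shows "AE_derivative (\<lambda>t. f t - g t) (\<lambda>t. f' t - g' t)"
  using assms unfolding AE_derivative_def
  by (auto intro: lipschitz_on_diff DERIV_diff elim!: eventually_elim2)

text \<open>The absolute values keep the constant nonnegative when \<open>S\<close> is empty, where
  \<open>A\<close> and \<open>B\<close> may be negative.\<close>

lemma lipschitz_on_mult_bounded:
  fixes f g :: "'a::metric_space \<Rightarrow> 'b::real_normed_algebra"
  assumes f: "C-lipschitz_on S f" and g: "D-lipschitz_on S g"
    and A: "\<And>x. x \<in> S \<Longrightarrow> norm (f x) \<le> A" and B: "\<And>x. x \<in> S \<Longrightarrow> norm (g x) \<le> B"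
  shows "(\<bar>A\<bar> * D + \<bar>B\<bar> * C)-lipschitz_on S (\<lambda>x. f x * g x)"
proof (rule lipschitz_onI)
  have CD: "0 \<le> C" "0 \<le> D"
    using f g by (auto dest: lipschitz_on_nonneg)
  then show "0 \<le> \<bar>A\<bar> * D + \<bar>B\<bar> * C" by simp
  fix x y assume xy: "x \<in> S" "y \<in> S"
  have "f x * g x - f y * g y = f x * (g x - g y) + (f x - f y) * g y"
    by (simp add: algebra_simps)
  then have "dist (f x * g x) (f y * g y) \<le> norm (f x) * norm (g x - g y) + norm (f x - f y) * norm (g y)"
    unfolding dist_norm by (metis norm_triangle_le add_mono norm_mult_ineq)
  also have "\<dots> \<le> \<bar>A\<bar> * (D * dist x y) + (C * dist x y) * \<bar>B\<bar>"
    using A[OF xy(1)] B[OF xy(2)] lipschitz_onD[OF f xy] lipschitz_onD[OF g xy] CD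
    by (intro add_mono mult_mono) (auto simp: dist_norm)
  finally show "dist (f x * g x) (f y * g y) \<le> (\<bar>A\<bar> * D + \<bar>B\<bar> * C) * dist x y"
    by (simp add: algebra_simps)
qed

lemma AE_derivative_mult:
  assumes "AE_derivative f f'" "AE_derivative g g'"
  shows "AE_derivative (\<lambda>t. f t * g t) (\<lambda>t. f' t * g t + g' t * f t)"
proof -
  obtain C D where lip: "C-lipschitz_on {0..1} f" "D-lipschitz_on {0..1} g"
    using assms unfolding AE_derivative_def by blast
  have bdd: "\<exists>A. \<forall>x\<in>{0..1}. norm (h x) \<le> A" if "K-lipschitz_on {0..1} h" for K and h :: "real \<Rightarrow> real"
    using compact_imp_bounded[OF compact_continuous_image[OF lipschitz_on_continuous_on[OF that]]]
    by (auto simp: bounded_iff)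
  obtain A B where "\<forall>x\<in>{0..1}. norm (f x) \<le> A" "\<forall>x\<in>{0..1}. norm (g x) \<le> B"
    using bdd[OF lip(1)] bdd[OF lip(2)] by blast
  then have "\<exists>K. K-lipschitz_on {0..1} (\<lambda>t. f t * g t)"
    using lipschitz_on_mult_bounded[OF lip, of A B] by blast
  then show ?thesis
    using assms unfolding AE_derivative_def by (auto intro: DERIV_mult elim!: eventually_elim2)
qed

lemma AE_derivative_cmult: "AE_derivative f f' \<Longrightarrow> AE_derivative (\<lambda>t. c * f t) (\<lambda>t. c * f' t)"
  using AE_derivative_mult[OF AE_derivative_const[of c], of f f'] by (simp add: mult.commute)

lemma AE_derivative_divide: "AE_derivative f f' \<Longrightarrow> AE_derivative (\<lambda>t. f t / c) (\<lambda>t. f' t / c)"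
  using AE_derivative_cmult[of f f' "inverse c"] by (simp add: field_simps)

lemma AE_derivative_power:
  assumes "AE_derivative f f'"
  shows "AE_derivative (\<lambda>t. f t ^ n) (\<lambda>t. of_nat n * f t ^ (n - 1) * f' t)"
proof (induction n)
  case (Suc n)
  \<comment> \<open>For \<open>n = 0\<close> the truncated exponent \<open>n - 1\<close> does no
    harm, since its term carries the factor 0.\<close>
  have "f' t * f t ^ n + of_nat n * f t ^ (n - 1) * f' t * f t = of_nat (Suc n) * f t ^ n * f' t" for t
    by (cases n) (simp_all add: algebra_simps)
  then show ?case
    using AE_derivative_mult[OF assms Suc] by simp
qed (simp add: AE_derivative_const)

lemma AE_derivative_minus: "AE_derivative f f' \<Longrightarrow> AE_derivative (\<lambda>t. - f t) (\<lambda>t. - f' t)"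
  using AE_derivative_cmult[of f f' "-1"] by simp

text \<open>Lets the rules below compute a derivative syntactically and simplify it afterwards.
  Equality is asked only on the unit interval, where the formulas for the multipliers are
  available.\<close>

lemma AE_derivative_eq_rhs:
  assumes "AE_derivative f f'" "\<And>t. t \<in> {0..1} \<Longrightarrow> f' t = g t"
  shows "AE_derivative f g"
proof -
  have "AE t in lebesgue_on {0..1}. (f has_real_derivative f' t) (at t within {0..1})"
    using assms(1) unfolding AE_derivative_def by blast
  moreover have "AE t in lebesgue_on {0..1}. t \<in> {0..1::real}"
    using AE_space[of "lebesgue_on {0..1::real}"] by simp
  ultimately have "AE t in lebesgue_on {0..1}. (f has_real_derivative g t) (at t within {0..1})"
    by eventually_elim (use assms(2) in auto)
  then show ?thesis
    using assms(1) unfolding AE_derivative_def by blast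
qed

lemmas AE_derivative_intros = AE_derivative_const AE_derivative_add AE_derivative_diff AE_derivative_minus
  AE_derivative_cmult AE_derivative_divide AE_derivative_mult AE_derivative_power

lemma AE_derivative_zero_constant:
  assumes "AE_derivative f f'" "AE t in lebesgue_on {0..1}. f' t = 0" "t \<in> {0..1}"
  shows "f t = f 0"
proof -
  obtain C where "C-lipschitz_on {0..1} f"
    using assms unfolding AE_derivative_def by blast
  moreover have "AE t in lebesgue_on {0..1}. (f has_real_derivative f' t) (at t within {0..1})"
    using assms unfolding AE_derivative_def by blast
  then have "AE t in lebesgue_on {0..1}. (f has_real_derivative 0) (at t within {0..1})"
    using assms(2) by eventually_elim simp
  ultimately show ?thesis
    using lipschitz_AE_derivative_zero_constant assms(3) by blast
qed

text \<open>Derivatives within a nondegenerate closed interval are unique, also at its endpoints.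
  Applied to the vanishing multipliers, this turns their adjoint equations into algebraic
  identities.\<close>

lemma AE_derivative_unique:
  assumes "AE_derivative f f'" "AE_derivative g g'" "\<And>t. t \<in> {0..1} \<Longrightarrow> f t = g t"
  shows "AE t in lebesgue_on {0..1}. f' t = g' t"
proof -
  have "AE t in lebesgue_on {0..1}. (f has_real_derivative f' t) (at t within {0..1})"
    "AE t in lebesgue_on {0..1}. (g has_real_derivative g' t) (at t within {0..1})"
    using assms unfolding AE_derivative_def by auto
  moreover have "AE t in lebesgue_on {0..1}. t \<in> {0..1::real}"
    using AE_space[of "lebesgue_on {0..1::real}"] by simp
  ultimately show ?thesis
  proof eventually_elim
    case (elim t)
    have "(g has_real_derivative f' t) (at t within {0..1})"
      using elim(1) by (rule has_field_derivative_transform_within[where d = 1])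
        (use elim(3) assms(3) in auto)
    then show ?case
      using elim vector_derivative_unique_within_closed_interval[of 0 1 t g "f' t" "g' t"]
      by (simp add: has_real_derivative_iff_has_vector_derivative)
  qed
qed

section \<open>Homogeneous polynomials\<close>

definition monomial :: "(8 \<Rightarrow> nat) \<Rightarrow> real^8 \<Rightarrow> real" where
  "monomial \<alpha> x = (\<Prod>j\<in>UNIV. (x$j) ^ \<alpha> j)"

text \<open>The definition sums over the exact support of the coefficients. Here any finite
  \<open>S\<close> is allowed and \<open>c\<close> may vanish on it, so cancellations need not be
  tracked.\<close>

lemma homogeneous_polynomialI:
  assumes "finite S" "\<And>\<alpha>. \<alpha> \<in> S \<Longrightarrow> (\<Sum>j\<in>UNIV. \<alpha> j * hdeg j) = k"
    and Q: "\<And>x. Q x = (\<Sum>\<alpha>\<in>S. c \<alpha> * monomial \<alpha> x)"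
  shows "homogeneous_polynomial k Q"
  unfolding homogeneous_polynomial_def
proof (intro exI[of _ "\<lambda>\<alpha>. if \<alpha> \<in> S then c \<alpha> else 0"] conjI allI impI)
  show "finite {\<alpha>. (if \<alpha> \<in> S then c \<alpha> else 0) \<noteq> 0}"
    by (rule finite_subset[OF _ assms(1)]) auto
  show "Q x = (\<Sum>\<alpha> | (if \<alpha> \<in> S then c \<alpha> else 0) \<noteq> 0.
      (if \<alpha> \<in> S then c \<alpha> else 0) * (\<Prod>j\<in>UNIV. (x$j) ^ \<alpha> j))" for x
    unfolding Q monomial_def by (rule sum.mono_neutral_cong_right[OF assms(1)]) (auto split: if_splits)
qed (use assms(2) in \<open>auto split: if_splits\<close>)

lemma homogeneous_polynomialE:
  assumes "homogeneous_polynomial k Q"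
  obtains S c where "finite S" "\<And>\<alpha>. \<alpha> \<in> S \<Longrightarrow> (\<Sum>j\<in>UNIV. \<alpha> j * hdeg j) = k"
    "Q = (\<lambda>x. \<Sum>\<alpha>\<in>S. c \<alpha> * monomial \<alpha> x)"
proof -
  obtain c where "finite {\<alpha>. c \<alpha> \<noteq> 0}"
    "\<forall>x. Q x = (\<Sum>\<alpha> | c \<alpha> \<noteq> 0. c \<alpha> * (\<Prod>j\<in>UNIV. (x$j) ^ \<alpha> j))"
    "\<forall>\<alpha>. c \<alpha> \<noteq> 0 \<longrightarrow> (\<Sum>j\<in>UNIV. \<alpha> j * hdeg j) = k"
    using assms unfolding homogeneous_polynomial_def by blast
  then show ?thesis
    by (intro that[of "{\<alpha>. c \<alpha> \<noteq> 0}" c]) (auto simp: monomial_def)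
qed

section \<open>Closure properties of homogeneous polynomials\<close>

lemma homogeneous_polynomial_monomial:
  "(\<Sum>j\<in>UNIV. \<alpha> j * hdeg j) = k \<Longrightarrow> homogeneous_polynomial k (\<lambda>x. c * monomial \<alpha> x)"
  by (rule homogeneous_polynomialI[of "{\<alpha>}" _ _ "\<lambda>_. c"]) auto

lemma homogeneous_polynomial_0: "homogeneous_polynomial k (\<lambda>x. 0)"
  by (rule homogeneous_polynomialI[of "{}"]) auto

lemma homogeneous_polynomial_add:
  assumes "homogeneous_polynomial k P" "homogeneous_polynomial k Q"
  shows "homogeneous_polynomial k (\<lambda>x. P x + Q x)"
proof -
  obtain S c where S: "finite S" "\<And>\<alpha>. \<alpha> \<in> S \<Longrightarrow> (\<Sum>j\<in>UNIV. \<alpha> j * hdeg j) = k"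
    and P: "P = (\<lambda>x. \<Sum>\<alpha>\<in>S. c \<alpha> * monomial \<alpha> x)"
    using homogeneous_polynomialE[OF assms(1)] by blast
  obtain T d where T: "finite T" "\<And>\<alpha>. \<alpha> \<in> T \<Longrightarrow> (\<Sum>j\<in>UNIV. \<alpha> j * hdeg j) = k"
    and Q: "Q = (\<lambda>x. \<Sum>\<alpha>\<in>T. d \<alpha> * monomial \<alpha> x)"
    using homogeneous_polynomialE[OF assms(2)] by blast
  have "P x = (\<Sum>\<alpha>\<in>S \<union> T. (if \<alpha> \<in> S then c \<alpha> else 0) * monomial \<alpha> x)"
    "Q x = (\<Sum>\<alpha>\<in>S \<union> T. (if \<alpha> \<in> T then d \<alpha> else 0) * monomial \<alpha> x)" for x
    unfolding P Q using S(1) T(1) by (auto intro!: sum.mono_neutral_cong_left)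
  then have "P x + Q x = (\<Sum>\<alpha>\<in>S \<union> T.
      ((if \<alpha> \<in> S then c \<alpha> else 0) + (if \<alpha> \<in> T then d \<alpha> else 0)) * monomial \<alpha> x)" for x
    by (simp only: sum.distrib[symmetric] distrib_right)
  then show ?thesis
    using S T by (intro homogeneous_polynomialI[of "S \<union> T"]) auto
qed

lemma homogeneous_polynomial_sum:
  assumes "\<And>i. i \<in> A \<Longrightarrow> homogeneous_polynomial k (f i)"
  shows "homogeneous_polynomial k (\<lambda>x. \<Sum>i\<in>A. f i x)"
  using assms
  by (induction A rule: infinite_finite_induct)
    (auto intro: homogeneous_polynomial_0 homogeneous_polynomial_add)

lemma homogeneous_polynomial_mult:
  assumes "homogeneous_polynomial m P" "homogeneous_polynomial n Q" "k = m + n"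
  shows "homogeneous_polynomial k (\<lambda>x. P x * Q x)"
proof -
  obtain S c where S: "finite S" "\<And>\<alpha>. \<alpha> \<in> S \<Longrightarrow> (\<Sum>j\<in>UNIV. \<alpha> j * hdeg j) = m"
    and P: "P = (\<lambda>x. \<Sum>\<alpha>\<in>S. c \<alpha> * monomial \<alpha> x)"
    using homogeneous_polynomialE[OF assms(1)] by blast
  obtain T d where T: "finite T" "\<And>\<alpha>. \<alpha> \<in> T \<Longrightarrow> (\<Sum>j\<in>UNIV. \<alpha> j * hdeg j) = n"
    and Q: "Q = (\<lambda>x. \<Sum>\<alpha>\<in>T. d \<alpha> * monomial \<alpha> x)"
    using homogeneous_polynomialE[OF assms(2)] by blast
  \<comment> \<open>Different pairs may yield the same exponent; closure under sums collects such
    terms.\<close>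
  have "P x * Q x = (\<Sum>\<alpha>\<in>S. \<Sum>\<beta>\<in>T. (c \<alpha> * d \<beta>) * monomial (\<lambda>j. \<alpha> j + \<beta> j) x)" for x
    unfolding P Q sum_product monomial_def power_add prod.distrib by (simp add: ac_simps)
  then show ?thesis
    using S(2) T(2) assms(3)
    by (auto intro!: homogeneous_polynomial_sum homogeneous_polynomial_monomial
        simp: sum.distrib distrib_right)
qed

lemma homogeneous_polynomial_const: "homogeneous_polynomial 0 (\<lambda>x. c)"
  using homogeneous_polynomial_monomial[of "\<lambda>_. 0" 0 c] by (simp add: monomial_def)

lemma homogeneous_polynomial_nth: "k = hdeg i \<Longrightarrow> homogeneous_polynomial k (\<lambda>x. x $ i)"
proof -
  have "monomial (\<lambda>j. if j = i then 1 else 0) x = x $ i" for x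
    unfolding monomial_def by (simp add: if_distrib[of "power _"] cong: if_cong)
  moreover assume "k = hdeg i"
  ultimately show ?thesis
    using homogeneous_polynomial_monomial[of "\<lambda>j. if j = i then 1 else 0" k 1]
    by (simp add: if_distrib[of "\<lambda>a. a * _"] cong: if_cong)
qed

lemma homogeneous_polynomial_cmult:
  "homogeneous_polynomial k P \<Longrightarrow> homogeneous_polynomial k (\<lambda>x. c * P x)"
  using homogeneous_polynomial_mult[OF homogeneous_polynomial_const] by simp

lemma homogeneous_polynomial_minus:
  "homogeneous_polynomial k P \<Longrightarrow> homogeneous_polynomial k (\<lambda>x. - P x)"
  using homogeneous_polynomial_cmult[of k P "-1"] by simp

lemma homogeneous_polynomial_diff:
  "homogeneous_polynomial k P \<Longrightarrow> homogeneous_polynomial k Q \<Longrightarrow>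
    homogeneous_polynomial k (\<lambda>x. P x - Q x)"
  using homogeneous_polynomial_add[OF _ homogeneous_polynomial_minus] by simp

lemma homogeneous_polynomial_divide:
  "homogeneous_polynomial k P \<Longrightarrow> homogeneous_polynomial k (\<lambda>x. P x / c)"
  using homogeneous_polynomial_cmult[of k P "inverse c"] by (simp add: field_simps)

lemma homogeneous_polynomial_prod:
  assumes "\<And>i. i \<in> A \<Longrightarrow> homogeneous_polynomial (d i) (f i)"
  shows "homogeneous_polynomial (\<Sum>i\<in>A. d i) (\<lambda>x. \<Prod>i\<in>A. f i x)"
  using assms
  by (induction A rule: infinite_finite_induct)
    (auto intro!: homogeneous_polynomial_const homogeneous_polynomial_mult)

lemma homogeneous_polynomial_power:
  "homogeneous_polynomial m P \<Longrightarrow> k = n * m \<Longrightarrow> homogeneous_polynomial k (\<lambda>x. P x ^ n)"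
  using homogeneous_polynomial_prod[of "{..<n}" "\<lambda>_. m" "\<lambda>_. P"] by simp

text \<open>Each Leibniz term takes one entry from every row and every column, so its degree is the
  sum of all row weights and all column weights, whatever the permutation.\<close>

lemma homogeneous_polynomial_det:
  fixes A :: "real^8 \<Rightarrow> real^'n^'n"
  assumes "\<And>i j. homogeneous_polynomial (r i + s j) (\<lambda>x. A x $ i $ j)"
  shows "homogeneous_polynomial (sum r UNIV + sum s UNIV) (\<lambda>x. det (A x))"
  unfolding det_def
proof (intro homogeneous_polynomial_sum homogeneous_polynomial_cmult)
  fix p :: "'n \<Rightarrow> 'n" assume "p \<in> {p. p permutes UNIV}"
  then have "sum s UNIV = (\<Sum>i\<in>UNIV. s (p i))"
    using sum.permute[of p UNIV s] by (simp add: o_def)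
  then show "homogeneous_polynomial (sum r UNIV + sum s UNIV) (\<lambda>x. \<Prod>i\<in>UNIV. A x $ i $ p i)"
    using homogeneous_polynomial_prod[of UNIV "\<lambda>i. r i + s (p i)" "\<lambda>i x. A x $ i $ p i"] assms
    by (simp add: sum.distrib)
qed

section \<open>The linear system satisfied by the coefficients of the conic\<close>

lemma exhaust_5:
  fixes i :: 5
  shows "i = 1 \<or> i = 2 \<or> i = 3 \<or> i = 4 \<or> i = 5"
proof (induct i)
  case (of_int z)
  then have "z \<in> {0,1,2,3,4}" by auto
  then show ?case by auto
qed

lemma UNIV_5: "(UNIV :: 5 set) = {1, 2, 3, 4, 5}"
  using exhaust_5 by blast

lemma sum_5: "sum f (UNIV :: 5 set) = f 1 + f 2 + f 3 + f 4 + f 5"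
  unfolding UNIV_5 by (simp add: ac_simps)

lemma forall_5: "(\<forall>i::5. P i) \<longleftrightarrow> P 1 \<and> P 2 \<and> P 3 \<and> P 4 \<and> P 5"
  by (metis exhaust_5)

lemma vector_5:
  "(vector [a, b, c, d, e] :: 'a::zero^5) $ 1 = a"
  "(vector [a, b, c, d, e] :: 'a^5) $ 2 = b"
  "(vector [a, b, c, d, e] :: 'a^5) $ 3 = c"
  "(vector [a, b, c, d, e] :: 'a^5) $ 4 = d"
  "(vector [a, b, c, d, e] :: 'a^5) $ 5 = e"
  unfolding vector_def by simp_all

text \<open>The columns belong to the functions -x1, -x2, x1^2/2, x1 x2, x2^2/2 that make up p. Row
  1 lists them; rows 2 to 5 list their primitives, zero at the origin, along horizontal curves
  against dx2, -dx1, x1 dx2 and x2 dx2. For example, dx3 = -x1 dx2 gives the entry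
  \<open>x$3\<close>.\<close>

definition abn_matrix :: "real^8 \<Rightarrow> real^5^5" where
  "abn_matrix x = vector [
    vector [- (x$1), - (x$2), (x$1)^2 / 2, x$1 * x$2, (x$2)^2 / 2],
    vector [x$3, - ((x$2)^2 / 2), x$4, x$5, (x$2)^3 / 6],
    vector [(x$1)^2 / 2, x$1 * x$2 + x$3, - ((x$1)^3 / 6), x$4 - (x$1)^2 * x$2 / 2,
      x$5 - x$1 * (x$2)^2 / 2],
    vector [- (2 * x$4), - (x$5), - (3 * x$6), - (2 * x$7), - (x$8)],
    vector [- (x$5), - ((x$2)^3 / 3), - (x$7), - (2 * x$8), (x$2)^4 / 8]]"

lemma abn_matrix_mult:
  "(abn_matrix x *v w) $ 1 = - x$1 * w$1 - x$2 * w$2 + (x$1)^2 / 2 * w$3 + x$1 * x$2 * w$4 + (x$2)^2 / 2 * w$5"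
  "(abn_matrix x *v w) $ 2 = x$3 * w$1 - (x$2)^2 / 2 * w$2 + x$4 * w$3 + x$5 * w$4 + (x$2)^3 / 6 * w$5"
  "(abn_matrix x *v w) $ 3 = (x$1)^2 / 2 * w$1 + (x$1 * x$2 + x$3) * w$2 - (x$1)^3 / 6 * w$3
     + (x$4 - (x$1)^2 * x$2 / 2) * w$4 + (x$5 - x$1 * (x$2)^2 / 2) * w$5"
  "(abn_matrix x *v w) $ 4 = - 2 * x$4 * w$1 - x$5 * w$2 - 3 * x$6 * w$3 - 2 * x$7 * w$4 - x$8 * w$5"
  "(abn_matrix x *v w) $ 5 = - x$5 * w$1 - (x$2)^3 / 3 * w$2 - x$7 * w$3 - 2 * x$8 * w$4 + (x$2)^4 / 8 * w$5"
  by (simp_all add: abn_matrix_def matrix_vector_mult_def sum_5 vector_5)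

lemma homogeneous_polynomial_det_abn_matrix:
  "homogeneous_polynomial 14 (\<lambda>x. det (abn_matrix x))"
proof -
  \<comment> \<open>\<open>r\<close> is the degree added by integrating against the form of each
    row, and \<open>s\<close> is the degree of the column's monomial. Their sums are 6 and 8, whence
    14.\<close>
  define r :: "5 \<Rightarrow> nat" where "r = (\<lambda>i. if i = 1 then 0 else if i \<in> {2, 3} then 1 else 2)"
  define s :: "5 \<Rightarrow> nat" where "s = (\<lambda>j. if j \<in> {1, 2} then 1 else 2)"
  have "\<forall>i j. homogeneous_polynomial (r i + s j) (\<lambda>x. abn_matrix x $ i $ j)"
    unfolding forall_5 abn_matrix_def vector_5
    by (intro conjI; (rule homogeneous_polynomial_nth[OF refl] homogeneous_polynomial_nth
      homogeneous_polynomial_add homogeneous_polynomial_diff homogeneous_polynomial_minus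
      homogeneous_polynomial_cmult homogeneous_polynomial_divide homogeneous_polynomial_mult
      homogeneous_polynomial_power | simp add: r_def s_def hdeg_def)+)
  then have "homogeneous_polynomial (sum r UNIV + sum s UNIV) (\<lambda>x. det (abn_matrix x))"
    by (intro homogeneous_polynomial_det) blast
  then show ?thesis
    by (simp add: sum_5 r_def s_def numeral_eq_Suc)
qed

lemma det_eq_0_if_kernel:
  fixes A :: "real^'n^'n"
  assumes "A *v w = 0" "w \<noteq> 0"
  shows "det A = 0"
  using assms by (metis invertible_det_nz invertible_left_inverse matrix_left_invertible_ker)

text \<open>At this point the system is triangular after reordering: rows 5, 4, 1, 2, 3 force the
  entries 1, 2, 3, 4, 5 of a kernel vector to vanish, in this order.\<close>

lemma det_abn_matrix_nonzero: "det (abn_matrix (axis 1 1 + axis 5 1)) \<noteq> 0"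
proof -
  have "w = 0" if "abn_matrix (axis 1 1 + axis 5 1) *v w = 0" for w
    using that unfolding vec_eq_iff forall_5 abn_matrix_mult by (simp add: axis_def)
  then show ?thesis
    by (metis invertible_det_nz invertible_left_inverse matrix_left_invertible_ker)
qed

section \<open>Abnormal extremals\<close>

text \<open>The horizontality equation read coordinatewise, with \<open>u\<close> and
  \<open>v\<close> the two controls. The first two clauses allow \<open>u\<close> and
  \<open>v\<close> to replace the \<open>vector_derivative\<close> terms of the adjoint
  equations.\<close>

lemma horizontal_AE_derivatives:
  assumes "horizontal \<gamma>"
  obtains u v where
    "AE t in lebesgue_on {0..1}. vector_derivative (\<lambda>s. \<gamma> s $ 1) (at t within {0..1}) = u t"
    "AE t in lebesgue_on {0..1}. vector_derivative (\<lambda>s. \<gamma> s $ 2) (at t within {0..1}) = v t"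
    "AE_derivative (\<lambda>t. \<gamma> t $ 1) u" "AE_derivative (\<lambda>t. \<gamma> t $ 2) v"
    "AE_derivative (\<lambda>t. \<gamma> t $ 3) (\<lambda>t. - (\<gamma> t $ 1) * v t)"
    "AE_derivative (\<lambda>t. \<gamma> t $ 4) (\<lambda>t. (\<gamma> t $ 1)^2 / 2 * v t)"
    "AE_derivative (\<lambda>t. \<gamma> t $ 5) (\<lambda>t. \<gamma> t $ 1 * \<gamma> t $ 2 * v t)"
    "AE_derivative (\<lambda>t. \<gamma> t $ 6) (\<lambda>t. - ((\<gamma> t $ 1)^3 / 6) * v t)"
    "AE_derivative (\<lambda>t. \<gamma> t $ 7) (\<lambda>t. - ((\<gamma> t $ 1)^2 * \<gamma> t $ 2 / 2) * v t)"
    "AE_derivative (\<lambda>t. \<gamma> t $ 8) (\<lambda>t. - (\<gamma> t $ 1 * (\<gamma> t $ 2)^2 / 2) * v t)"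
proof -
  obtain C and h :: "real \<Rightarrow> real^2" where lip: "C-lipschitz_on {0..1} \<gamma>"
    and der: "AE t in lebesgue_on {0..1}. (\<gamma> has_vector_derivative
          (h t $ 1) *\<^sub>R X1 (\<gamma> t) + (h t $ 2) *\<^sub>R X2 (\<gamma> t)) (at t within {0..1})"
    using assms unfolding horizontal_def by blast
  have "C-lipschitz_on {0..1} (\<lambda>t. \<gamma> t $ i)" for i
    using lip unfolding lipschitz_on_def
    by (meson dist_vec_nth_le order_trans)
  then have comp: "AE_derivative (\<lambda>t. \<gamma> t $ i) (\<lambda>t. h t $ 1 * X1 (\<gamma> t) $ i + h t $ 2 * X2 (\<gamma> t) $ i)" for i
    using der unfolding AE_derivative_def has_real_derivative_iff_has_vector_derivative
    by (auto elim!: eventually_mono dest: bounded_linear.has_vector_derivative[OF bounded_linear_vec_nth, of _ _ _ i])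
  have vd: "AE t in lebesgue_on {0..1}. vector_derivative f (at t within {0..1}) = f' t"
    if "AE_derivative f f'" for f f'
    using that AE_space[of "lebesgue_on {0..1::real}"] unfolding AE_derivative_def
    by (auto elim!: eventually_elim2 intro!: vector_derivative_within_closed_interval
        simp: has_real_derivative_iff_has_vector_derivative)
  show thesis
    using vd[OF comp[of 1]] vd[OF comp[of 2]] comp[of 1] comp[of 2] comp[of 3] comp[of 4]
      comp[of 5] comp[of 6] comp[of 7] comp[of 8]
    by (intro that[of "\<lambda>t. h t $ 1" "\<lambda>t. h t $ 2"])
      (simp_all add: X1_def X2_def axis_def mult.commute)
qed

lemma abnormal_extremal_det_zero:
  assumes abn: "abnormal_extremal \<gamma>" and start: "\<gamma> 0 = 0" and t: "t \<in> {0..1}"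
  shows "det (abn_matrix (\<gamma> t)) = 0"
proof -
  obtain u v where uv:
    "AE t in lebesgue_on {0..1}. vector_derivative (\<lambda>s. \<gamma> s $ 1) (at t within {0..1}) = u t"
    "AE t in lebesgue_on {0..1}. vector_derivative (\<lambda>s. \<gamma> s $ 2) (at t within {0..1}) = v t"
    and x: "AE_derivative (\<lambda>t. \<gamma> t $ 1) u" "AE_derivative (\<lambda>t. \<gamma> t $ 2) v"
    "AE_derivative (\<lambda>t. \<gamma> t $ 3) (\<lambda>t. - (\<gamma> t $ 1) * v t)"
    "AE_derivative (\<lambda>t. \<gamma> t $ 4) (\<lambda>t. (\<gamma> t $ 1)^2 / 2 * v t)"
    "AE_derivative (\<lambda>t. \<gamma> t $ 5) (\<lambda>t. \<gamma> t $ 1 * \<gamma> t $ 2 * v t)"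
    "AE_derivative (\<lambda>t. \<gamma> t $ 6) (\<lambda>t. - ((\<gamma> t $ 1)^3 / 6) * v t)"
    "AE_derivative (\<lambda>t. \<gamma> t $ 7) (\<lambda>t. - ((\<gamma> t $ 1)^2 * \<gamma> t $ 2 / 2) * v t)"
    "AE_derivative (\<lambda>t. \<gamma> t $ 8) (\<lambda>t. - (\<gamma> t $ 1 * (\<gamma> t $ 2)^2 / 2) * v t)"
  proof (rule horizontal_AE_derivatives)
    show "horizontal \<gamma>"
      using abn unfolding abnormal_extremal_def by blast
  qed
  obtain l where lip: "\<forall>i. \<exists>C. C-lipschitz_on {0..1} (l i)"
    and nz: "\<forall>t\<in>{0..1}. \<exists>i. l i t \<noteq> 0"
    and l12: "\<forall>t\<in>{0..1}. l 1 t = 0 \<and> l 2 t = 0"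
    and l: "\<forall>i. AE t in lebesgue_on {0..1}. (l i has_vector_derivative
           - (\<Sum>k\<in>UNIV. \<Sum>j\<in>{1, 2}. struct_const i j k *
               vector_derivative (\<lambda>s. \<gamma> s $ j) (at t within {0..1}) * l k t))
           (at t within {0..1})"
    using abn unfolding abnormal_extremal_def by (elim conjE exE)
  have l': "AE_derivative (l i)
      (\<lambda>t. - (\<Sum>k\<in>UNIV. struct_const i 1 k * u t * l k t + struct_const i 2 k * v t * l k t))" for i
    unfolding AE_derivative_def has_real_derivative_iff_has_vector_derivative
  proof
    show "\<exists>C. C-lipschitz_on {0..1} (l i)"
      using lip by blast
    show "AE t in lebesgue_on {0..1}. (l i has_vector_derivative
        - (\<Sum>k\<in>UNIV. struct_const i 1 k * u t * l k t + struct_const i 2 k * v t * l k t))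
        (at t within {0..1})"
      using l[rule_format, of i] uv by eventually_elim simp
  qed
  \<comment> \<open>The signs in the first two equations differ because [X2, X1] = X3 and [X1, X2] =
    -X3. The last three multipliers are constant because X6, X7, X8 are central.\<close>
  have ld: "AE_derivative (l 1) (\<lambda>t. v t * l 3 t)"
    "AE_derivative (l 2) (\<lambda>t. - u t * l 3 t)"
    "AE_derivative (l 3) (\<lambda>t. - u t * l 4 t - v t * l 5 t)"
    "AE_derivative (l 4) (\<lambda>t. - u t * l 6 t - v t * l 7 t)"
    "AE_derivative (l 5) (\<lambda>t. - u t * l 7 t - v t * l 8 t)"
    "AE_derivative (l 6) (\<lambda>t. 0)"
    "AE_derivative (l 7) (\<lambda>t. 0)"
    "AE_derivative (l 8) (\<lambda>t. 0)"
    by (rule AE_derivative_eq_rhs[OF l'], simp add: sum_8 struct_const_eq struct_table_def)+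
  have vl3: "AE t in lebesgue_on {0..1}. v t * l 3 t = 0"
    using AE_derivative_unique[OF ld(1) AE_derivative_const[of 0]] l12 by simp
  have ul3: "AE t in lebesgue_on {0..1}. - u t * l 3 t = 0"
    using AE_derivative_unique[OF ld(2) AE_derivative_const[of 0]] l12 by simp
  have space: "AE t in lebesgue_on {0..1}. t \<in> {0..1::real}"
    using AE_space[of "lebesgue_on {0..1::real}"] by simp
  \<comment> \<open>The derivative of the square of \<open>l 3\<close>, in the form given by the
    power rule, contains the products \<open>u t * l 3 t\<close> and \<open>v t * l 3 t\<close>,
    which vanish almost everywhere. Hence \<open>l 3\<close> vanishes everywhere or nowhere.\<close>
  have "AE t in lebesgue_on {0..1}. of_nat 2 * l 3 t ^ (2 - 1) * (- u t * l 4 t - v t * l 5 t) = 0"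
    using vl3 ul3 by eventually_elim auto
  then have "l 3 t ^ 2 = l 3 0 ^ 2" if "t \<in> {0..1}" for t
    using AE_derivative_zero_constant[OF AE_derivative_power[OF ld(3)] _ that] by blast
  then have l3: "l 3 t = 0 \<longleftrightarrow> l 3 0 = 0" if "t \<in> {0..1}" for t
    using that by (metis zero_eq_power2)
  show ?thesis
  proof (cases "l 3 0 = 0")
    case False
    then have l3_nz: "l 3 t \<noteq> 0" if "t \<in> {0..1}" for t
      using l3[OF that] by blast
    have u0: "AE t in lebesgue_on {0..1}. u t = 0"
      using space ul3 by eventually_elim (use l3_nz in auto)
    have v0: "AE t in lebesgue_on {0..1}. v t = 0"
      using space vl3 by eventually_elim (use l3_nz in auto)
    have "\<gamma> t $ 1 = 0"
      using AE_derivative_zero_constant[OF x(1) u0 t] start by simp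
    moreover have "\<gamma> t $ i = 0" if "AE_derivative (\<lambda>t. \<gamma> t $ i) (\<lambda>t. f t * v t)" for i f
    proof -
      have "AE t in lebesgue_on {0..1}. f t * v t = 0"
        using v0 by eventually_elim simp
      then show ?thesis
        using AE_derivative_zero_constant[OF that _ t] start by simp
    qed
    note this[OF x(3)] this[OF x(4)] this[OF x(5)] this[OF x(6)] this[OF x(7)] this[OF x(8)]
    moreover have "\<gamma> t $ 2 = 0"
      using AE_derivative_zero_constant[OF x(2) v0 t] start by simp
    \<comment> \<open>The curve stays at the origin, where the whole matrix is zero; any nonzero
      vector would serve.\<close>
    ultimately have "abn_matrix (\<gamma> t) *v axis 1 1 = 0"
      unfolding vec_eq_iff forall_5 abn_matrix_mult by simp
    then show ?thesis
      by (rule det_eq_0_if_kernel) simp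
  next
    case True
    note poly = AE_derivative_intros x
    define c where "c i = l i 0" for i
    have c678: "l 6 t = c 6" "l 7 t = c 7" "l 8 t = c 8" if "t \<in> {0..1}" for t
      using AE_derivative_zero_constant[OF ld(6) _ that] AE_derivative_zero_constant[OF ld(7) _ that]
        AE_derivative_zero_constant[OF ld(8) _ that] by (simp_all add: c_def)
    \<comment> \<open>With \<open>l 6\<close>, \<open>l 7\<close>, \<open>l 8\<close> constant, the
      adjoint equations for \<open>l 4\<close> and \<open>l 5\<close> integrate to affine functions
      of the first two coordinates.\<close>
    have c4: "l 4 t + c 6 * \<gamma> t $ 1 + c 7 * \<gamma> t $ 2 = c 4" if "t \<in> {0..1}" for t
    proof -
      have "AE_derivative (\<lambda>t. l 4 t + c 6 * \<gamma> t $ 1 + c 7 * \<gamma> t $ 2) (\<lambda>t. 0)"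
        by (rule AE_derivative_eq_rhs, (rule poly ld)+) (simp add: c678)
      from AE_derivative_zero_constant[OF this _ that] show ?thesis
        by (simp add: start c_def)
    qed
    have c5: "l 5 t + c 7 * \<gamma> t $ 1 + c 8 * \<gamma> t $ 2 = c 5" if "t \<in> {0..1}" for t
    proof -
      have "AE_derivative (\<lambda>t. l 5 t + c 7 * \<gamma> t $ 1 + c 8 * \<gamma> t $ 2) (\<lambda>t. 0)"
        by (rule AE_derivative_eq_rhs, (rule poly ld)+) (simp add: c678)
      from AE_derivative_zero_constant[OF this _ that] show ?thesis
        by (simp add: start c_def)
    qed
    \<comment> \<open>The initial multipliers are the coefficients of p, and \<open>P\<close> is p
      evaluated along the curve.\<close>
    define w :: "real^5" where "w = vector [c 4, c 5, c 6, c 7, c 8]"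
    define P where "P t = (abn_matrix (\<gamma> t) *v w) $ 1" for t
    have w: "w $ 1 = c 4" "w $ 2 = c 5" "w $ 3 = c 6" "w $ 4 = c 7" "w $ 5 = c 8"
      by (simp_all add: w_def vector_5)
    have row0: "(abn_matrix (\<gamma> 0) *v w) $ i = 0" for i
      using start exhaust_5[of i] by (auto simp: abn_matrix_mult)
    have l4: "l 4 t = c 4 - c 6 * \<gamma> t $ 1 - c 7 * \<gamma> t $ 2"
      and l5: "l 5 t = c 5 - c 7 * \<gamma> t $ 1 - c 8 * \<gamma> t $ 2" if "t \<in> {0..1}" for t
      using c4[OF that] c5[OF that] by simp_all
    \<comment> \<open>\<open>l 3\<close> and \<open>P\<close> have the same derivative and both
      vanish at time 0, while \<open>l 3\<close> is identically zero in this case.\<close>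
    have row1: "P t = 0" if "t \<in> {0..1}" for t
    proof -
      have "AE_derivative (\<lambda>t. l 3 t - P t) (\<lambda>t. 0)"
        unfolding P_def abn_matrix_mult w
        by (rule AE_derivative_eq_rhs, (rule poly ld)+) (simp add: l4 l5 algebra_simps)
      from AE_derivative_zero_constant[OF this _ that] have "l 3 t - P t = l 3 0 - P 0"
        by simp
      then show ?thesis
        using True l3[OF that] row0[of 1] by (simp add: P_def)
    qed
    \<comment> \<open>The other rows start at 0, and a derivative that is a multiple of
      \<open>P\<close> vanishes by \<open>row1\<close>.\<close>
    have rowI: "(abn_matrix (\<gamma> t) *v w) $ i = 0"
      if "AE_derivative (\<lambda>t. (abn_matrix (\<gamma> t) *v w) $ i) (\<lambda>t. f t * P t)" for i f
    proof -
      have "AE t in lebesgue_on {0..1}. f t * P t = 0"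
        using space by eventually_elim (simp add: row1)
      then show ?thesis
        using AE_derivative_zero_constant[OF that _ t] row0 by simp
    qed
    have d2: "AE_derivative (\<lambda>t. (abn_matrix (\<gamma> t) *v w) $ 2) (\<lambda>t. v t * P t)"
      unfolding P_def abn_matrix_mult w
      by (rule AE_derivative_eq_rhs, (rule poly)+) (simp add: field_simps power2_eq_square)
    \<comment> \<open>Integration by parts keeps the integrals against dx1 polynomial: for instance
      x2 dx1 = d(x1 x2 + x3), since dx3 = -x1 dx2.\<close>
    have d3: "AE_derivative (\<lambda>t. (abn_matrix (\<gamma> t) *v w) $ 3) (\<lambda>t. - u t * P t)"
      unfolding P_def abn_matrix_mult w
      by (rule AE_derivative_eq_rhs, (rule poly)+) (simp add: field_simps power2_eq_square)
    have d4: "AE_derivative (\<lambda>t. (abn_matrix (\<gamma> t) *v w) $ 4) (\<lambda>t. (\<gamma> t $ 1 * v t) * P t)"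
      unfolding P_def abn_matrix_mult w
      by (rule AE_derivative_eq_rhs, (rule poly)+)
        (simp add: field_simps power2_eq_square power3_eq_cube)
    have d5: "AE_derivative (\<lambda>t. (abn_matrix (\<gamma> t) *v w) $ 5) (\<lambda>t. (\<gamma> t $ 2 * v t) * P t)"
      unfolding P_def abn_matrix_mult w
      by (rule AE_derivative_eq_rhs, (rule poly)+)
        (simp add: field_simps power2_eq_square power3_eq_cube)
    have "abn_matrix (\<gamma> t) *v w = 0"
      using rowI[OF d2] rowI[OF d3] rowI[OF d4] rowI[OF d5] row1[OF t]
      unfolding vec_eq_iff forall_5 by (simp add: P_def)
    \<comment> \<open>The first three multipliers vanish at time 0, so \<open>w = 0\<close> would
      make all eight vanish there.\<close>
    moreover have "w \<noteq> 0"
    proof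
      assume "w = 0"
      then have "l i 0 = 0" for i
        using w bspec[OF l12, of 0] True exhaust_8[of i] by (auto simp: c_def)
      then show False
        using bspec[OF nz, of 0] by auto
    qed
    ultimately show ?thesis
      by (rule det_eq_0_if_kernel)
  qed
qed

theorem theorem4p1:
  shows "\<exists>(Q :: real^8 \<Rightarrow> real) k.
    homogeneous_polynomial k Q \<and> Q \<noteq> (\<lambda>x. 0) \<and>
    (\<forall>\<gamma> :: real \<Rightarrow> real^8. abnormal_extremal \<gamma> \<and> \<gamma> 0 = 0 \<longrightarrow> (\<forall>t\<in>{0..1}. Q (\<gamma> t) = 0))"
proof (intro exI conjI)
  show "homogeneous_polynomial 14 (\<lambda>x. det (abn_matrix x))"
    by (rule homogeneous_polynomial_det_abn_matrix)
  show "(\<lambda>x. det (abn_matrix x)) \<noteq> (\<lambda>x. 0)"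
    using det_abn_matrix_nonzero by metis
qed (use abnormal_extremal_det_zero in blast)

end
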